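(* Let $\lambda$ be any partition, $z$ a content with $|z|=|\lambda|$, and $F,S$ cardinal fillings of shape $\lambda$ and content $z$. Let $1\le j<\lambda_1$, $p=\zeta_j$, and for $1\le l\le p$ let $F_l$ be the filling obtained from $F$ by exchanging the top entry of column $j+1$ with the $l$-th entry of column $j$ (so that $F-\sum_{l=1}^pF_l$ is a simple Plücker relation). Then $$R(F,S)-\sum_{l=1}^p R(F_l,S)=0.$$
   Context: Fix $n\ge 2$. A partition $\lambda$ is identified with its Young diagram with column lengths $\zeta_1\ge\cdots\ge\zeta_{\lambda_1}$; $(r,c)$ is the box in row $r$, column $c$. A filling of shape $\lambda$ assigns a value in $\{1,\dots,n\}$ to each box; its content $z=(z_1,\dots,z_n)$ counts occurrences of each value. Cardinal: no repeated value in a column. Same row content: for each row, the multisets of entries of that row agree. $\mathfrak{S}_\lambda=\prod_c\mathfrak{S}_{\zeta_c}$ (multipermutations) acts by $F_{\underline\pi}(r,c)=F(\pi_c(r),c)$, with $\mathrm{sgn}(\underline\pi)=\prod_c\mathrm{sgn}(\pi_c)$. The rearrangement coefficient of fillings $F,S$ of shape $\lambda$ and equal content is $R(F,S)=\sum\mathrm{sgn}(\underline\pi)$ over all $\underline\pi\in\mathfrak{S}_\lambda$ such that $F_{\underline\pi}$ has the same row content as $S$. *)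

theory Defs
  imports "HOL-Combinatorics.Permutations" "HOL-Combinatorics.Transposition"
    "HOL-Library.Multiset" "HOL-Library.FuncSet"
begin

text \<open>A partition is the weakly decreasing list of its positive row lengths.
  Rows and columns are counted from 1.\<close>

definition is_partition :: "nat list \<Rightarrow> bool" where
  "is_partition lam \<longleftrightarrow> sorted_wrt (\<ge>) lam \<and> 0 \<notin> set lam"

definition row_len :: "nat list \<Rightarrow> nat \<Rightarrow> nat" where
  "row_len lam r = (if 1 \<le> r \<and> r \<le> length lam then lam ! (r - 1) else 0)"

definition young_diagram :: "nat list \<Rightarrow> (nat \<times> nat) set" where
  "young_diagram lam = {(r, c). 1 \<le> r \<and> 1 \<le> c \<and> c \<le> row_len lam r}"

definition col_len :: "nat list \<Rightarrow> nat \<Rightarrow> nat" where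
  "col_len lam c = card {r. (r, c) \<in> young_diagram lam}"

definition fillings :: "nat \<Rightarrow> nat list \<Rightarrow> (nat \<times> nat \<Rightarrow> nat) set" where
  "fillings n lam = young_diagram lam \<rightarrow>\<^sub>E {1..n}"

definition content :: "nat list \<Rightarrow> (nat \<times> nat \<Rightarrow> nat) \<Rightarrow> nat \<Rightarrow> nat" where
  "content lam F i = card {b \<in> young_diagram lam. F b = i}"

definition cardinal_filling :: "nat list \<Rightarrow> (nat \<times> nat \<Rightarrow> nat) \<Rightarrow> bool" where
  "cardinal_filling lam F \<longleftrightarrow>
     (\<forall>c\<in>{1..row_len lam 1}. inj_on (\<lambda>r. F (r, c)) {1..col_len lam c})"

definition row_content :: "nat list \<Rightarrow> (nat \<times> nat \<Rightarrow> nat) \<Rightarrow> nat \<Rightarrow> nat multiset" where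
  "row_content lam F r = image_mset (\<lambda>c. F (r, c)) (mset_set {1..row_len lam r})"

definition same_row_content ::
  "nat list \<Rightarrow> (nat \<times> nat \<Rightarrow> nat) \<Rightarrow> (nat \<times> nat \<Rightarrow> nat) \<Rightarrow> bool" where
  "same_row_content lam F S \<longleftrightarrow>
     (\<forall>r\<in>{1..length lam}. row_content lam F r = row_content lam S r)"

text \<open>Extensionality outside the column range makes each multipermutation occur
  exactly once.\<close>

definition multiperms :: "nat list \<Rightarrow> (nat \<Rightarrow> nat \<Rightarrow> nat) set" where
  "multiperms lam = (\<Pi>\<^sub>E c\<in>{1..row_len lam 1}. {p. p permutes {1..col_len lam c}})"

definition multiperm_sign :: "nat list \<Rightarrow> (nat \<Rightarrow> nat \<Rightarrow> nat) \<Rightarrow> int" where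
  "multiperm_sign lam P = (\<Prod>c\<in>{1..row_len lam 1}. sign (P c))"

definition multiperm_act ::
  "nat list \<Rightarrow> (nat \<Rightarrow> nat \<Rightarrow> nat) \<Rightarrow> (nat \<times> nat \<Rightarrow> nat) \<Rightarrow> (nat \<times> nat \<Rightarrow> nat)" where
  "multiperm_act lam P F = restrict (\<lambda>(r, c). F (P c r, c)) (young_diagram lam)"

definition rearrangement_coeff ::
  "nat list \<Rightarrow> (nat \<times> nat \<Rightarrow> nat) \<Rightarrow> (nat \<times> nat \<Rightarrow> nat) \<Rightarrow> int" where
  "rearrangement_coeff lam F S =
     (\<Sum>P\<in>{P \<in> multiperms lam. same_row_content lam (multiperm_act lam P F) S}.
        multiperm_sign lam P)"

definition exchange ::
  "(nat \<times> nat \<Rightarrow> nat) \<Rightarrow> nat \<Rightarrow> nat \<Rightarrow> (nat \<times> nat \<Rightarrow> nat)" where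
  "exchange F j l = F \<circ> transpose (1, j + 1) (l, j)"

end

theory Submission
  imports Defs
begin

text \<open>Adjoin the top box of column \<open>j + 1\<close> to column \<open>j\<close> as an extra box with index \<open>0\<close>. The
  identity and the \<open>p\<close> exchanges are the coset representatives of the symmetric group of column
  \<open>j\<close> in the symmetric group of the enlarged column, so the left-hand side is a signed sum over
  all permutations \<open>g\<close> of the enlarged column and all permutations of the other columns. Once the
  latter are fixed, the adjoined box ends up in some row \<open>r \<le> \<zeta>\<^bsub>j+1\<^esub> \<le> p\<close>; composing \<open>g\<close> with the
  transposition \<open>(0 r)\<close> swaps the entries of columns \<open>j\<close> and \<open>j + 1\<close> in that row, hence preserves
  the row content but reverses the sign.\<close>

lemma row_len_antimono:
  assumes "is_partition lam" "1 \<le> r" "r \<le> s"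
  shows "row_len lam s \<le> row_len lam r"
proof (cases "s \<le> length lam \<and> r < s")
  case True
  then have "r - 1 < s - 1" "s - 1 < length lam" using assms by auto
  then have "lam ! (s - 1) \<le> lam ! (r - 1)"
    using assms(1) unfolding is_partition_def by (auto simp: sorted_wrt_iff_nth_less)
  then show ?thesis using True assms by (auto simp: row_len_def)
qed (use assms in \<open>auto simp: row_len_def\<close>)

text \<open>Weakly decreasing row lengths make the rows meeting a column a downward closed set,
  hence an initial segment. This turns bounds by \<open>col_len\<close> into membership in the
  diagram and back.\<close>

lemma column_eq:
  assumes "is_partition lam"
  shows "{r. (r, c) \<in> young_diagram lam} = {1..col_len lam c}"
proof -
  let ?A = "{r. (r, c) \<in> young_diagram lam}"
  have "?A \<subseteq> {1..length lam}"
    by (auto simp: young_diagram_def row_len_def split: if_splits)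
  then have fin: "finite ?A" by (rule finite_subset) simp
  have down: "{1..r} \<subseteq> ?A" if "r \<in> ?A" for r
    using that row_len_antimono[OF assms] by (fastforce simp: young_diagram_def)
  \<comment> \<open>Inserting \<open>0\<close> keeps the maximum meaningful for an empty
    column.\<close>
  have "?A = {1..Max (insert 0 ?A)}"
  proof (intro subset_antisym)
    show "?A \<subseteq> {1..Max (insert 0 ?A)}"
      using fin by (auto simp: young_diagram_def intro!: Max_ge)
    show "{1..Max (insert 0 ?A)} \<subseteq> ?A"
      using Max_in[of "insert 0 ?A"] fin down by (cases "Max (insert 0 ?A) = 0") auto
  qed
  then show ?thesis unfolding col_len_def by (metis card_atLeastAtMost diff_Suc_1)
qed

lemma same_row_content_cong:
  assumes "\<And>r. r \<in> {1..length lam} \<Longrightarrow> row_content lam F r = row_content lam G r"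
  shows "same_row_content lam F S \<longleftrightarrow> same_row_content lam G S"
  using assms by (auto simp: same_row_content_def)

lemma row_content_cong:
  assumes "\<And>c. c \<in> {1..row_len lam r} \<Longrightarrow> F (r, c) = G (r, c)"
  shows "row_content lam F r = row_content lam G r"
  unfolding row_content_def using assms by (intro image_mset_cong) auto

lemma row_content_swap:
  assumes "a \<in> {1..row_len lam r}" "b \<in> {1..row_len lam r}"
    and "\<And>c. c \<in> {1..row_len lam r} \<Longrightarrow> G (r, c) = F (r, transpose a b c)"
  shows "row_content lam G r = row_content lam F r"
proof -
  let ?A = "{1..row_len lam r}"
  have perm: "transpose a b permutes ?A"
    using assms by (intro permutes_swap_id) auto
  have "row_content lam G r = image_mset (\<lambda>c. F (r, transpose a b c)) (mset_set ?A)"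
    unfolding row_content_def using assms(3) by (intro image_mset_cong) auto
  also have "\<dots> = image_mset (\<lambda>c. F (r, c)) (image_mset (transpose a b) (mset_set ?A))"
    by (simp add: multiset.map_comp o_def)
  also have "image_mset (transpose a b) (mset_set ?A) = mset_set ?A"
    using permutes_image[OF perm] permutes_inj_on[OF perm] by (simp add: image_mset_mset_set)
  finally show ?thesis by (simp add: row_content_def)
qed

lemma finite_multiperms [simp]: "finite (multiperms lam)"
  unfolding multiperms_def by (intro finite_PiE) (auto intro: finite_permutations)

lemma sum_PiE_remove:
  assumes "i \<in> I"
  shows "(\<Sum>P\<in>PiE I T. f P) = (\<Sum>Q\<in>PiE (I - {i}) T. \<Sum>x\<in>T i. f (Q(i := x)))"
proof -
  have I: "I = insert i (I - {i})" using assms by auto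
  have "(\<Sum>P\<in>PiE I T. f P) = (\<Sum>P\<in>(\<lambda>(y, g). g(i := y)) ` (T i \<times> PiE (I - {i}) T). f P)"
    by (subst I, subst PiE_insert_eq) simp
  also have "\<dots> = (\<Sum>(x, Q)\<in>T i \<times> PiE (I - {i}) T. f (Q(i := x)))"
    using inj_combinator[of i "I - {i}" T] by (subst sum.reindex) (auto simp: case_prod_unfold)
  also have "\<dots> = (\<Sum>Q\<in>PiE (I - {i}) T. \<Sum>x\<in>T i. f (Q(i := x)))"
    by (subst sum.swap) (simp only: sum.cartesian_product)
  finally show ?thesis .
qed

text \<open>The row condition moves into a 0/1 weight, so the index set no longer depends on the
  filling. With the other columns fixed outside, the inner sums for \<open>F\<close> and its
  exchanges can later be merged.\<close>

lemma rearrangement_coeff_split_column: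
  assumes "j \<in> {1..row_len lam 1}"
  shows "rearrangement_coeff lam F S =
    (\<Sum>Q\<in>(\<Pi>\<^sub>E c\<in>{1..row_len lam 1} - {j}. {p. p permutes {1..col_len lam c}}).
       (\<Prod>c\<in>{1..row_len lam 1} - {j}. sign (Q c)) *
       (\<Sum>\<pi> | \<pi> permutes {1..col_len lam j}.
          sign \<pi> * of_bool (same_row_content lam (multiperm_act lam (Q(j := \<pi>)) F) S)))"
proof -
  let ?I = "{1..row_len lam 1}"
  have sgn: "multiperm_sign lam (Q(j := \<pi>)) = (\<Prod>c\<in>?I - {j}. sign (Q c)) * sign \<pi>" for Q \<pi>
    unfolding multiperm_sign_def using assms by (subst prod.remove[of _ j]) auto
  have "rearrangement_coeff lam F S = (\<Sum>P\<in>multiperms lam.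
      multiperm_sign lam P * of_bool (same_row_content lam (multiperm_act lam P F) S))"
    unfolding rearrangement_coeff_def
    by (intro sum.mono_neutral_cong_left) auto
  also have "\<dots> = (\<Sum>Q\<in>(\<Pi>\<^sub>E c\<in>?I - {j}. {p. p permutes {1..col_len lam c}}).
      \<Sum>\<pi> | \<pi> permutes {1..col_len lam j}. multiperm_sign lam (Q(j := \<pi>)) *
        of_bool (same_row_content lam (multiperm_act lam (Q(j := \<pi>)) F) S))"
    unfolding multiperms_def by (rule sum_PiE_remove[OF assms])
  finally show ?thesis by (simp add: sgn sum_distrib_left mult.assoc)
qed

text \<open>Index \<open>0\<close> stands for the top box of column \<open>j + 1\<close>, adjoined to column \<open>j\<close>.\<close>

definition enlarged_column :: "(nat \<times> nat \<Rightarrow> nat) \<Rightarrow> nat \<Rightarrow> nat \<Rightarrow> nat" where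
  "enlarged_column F j s = (if s = 0 then F (1, j + 1) else F (s, j))"

text \<open>The permutation \<open>g\<close> of the enlarged column supplies column \<open>j\<close>
  and also the one box of column \<open>j + 1\<close> to which \<open>Q\<close> carries the top
  entry; that box receives index \<open>g 0\<close>.\<close>

definition enlarged_act ::
  "(nat \<times> nat \<Rightarrow> nat) \<Rightarrow> nat \<Rightarrow> (nat \<Rightarrow> nat) \<Rightarrow> (nat \<Rightarrow> nat \<Rightarrow> nat) \<Rightarrow> (nat \<times> nat \<Rightarrow> nat)" where
  "enlarged_act F j g Q = (\<lambda>(r, c).
     if c = j then enlarged_column F j (g r)
     else if c = j + 1 \<and> Q c r = 1 then enlarged_column F j (g 0)
     else F (Q c r, c))"

text \<open>An exchange with row \<open>b\<close> is the transposition (0 b) of the enlarged column,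
  and \<open>b = 0\<close> gives \<open>F\<close> itself. Since \<open>\<pi>\<close> fixes
  \<open>0\<close>, the adjoined box receives index \<open>b\<close>.\<close>

lemma same_row_content_act:
  assumes \<pi>: "\<pi> permutes {1..p}" and b: "b \<in> {0..p}"
  shows "same_row_content lam
      (multiperm_act lam (Q(j := \<pi>)) (if b = 0 then F else exchange F j b)) S \<longleftrightarrow>
    same_row_content lam (enlarged_act F j (transpose 0 b \<circ> \<pi>) Q) S"
proof (intro same_row_content_cong row_content_cong)
  fix r c assume r: "r \<in> {1..length lam}" and c: "c \<in> {1..row_len lam r}"
  have "\<pi> 0 = 0" using \<pi> by (auto simp: permutes_def)
  moreover have "\<pi> r \<noteq> 0"
    using r calculation permutes_inj[OF \<pi>] by (metis atLeastAtMost_iff injD not_one_le_zero)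
  ultimately show "multiperm_act lam (Q(j := \<pi>)) (if b = 0 then F else exchange F j b) (r, c) =
      enlarged_act F j (transpose 0 b \<circ> \<pi>) Q (r, c)"
    using r c
    by (auto simp: multiperm_act_def young_diagram_def enlarged_act_def enlarged_column_def
        exchange_def transpose_def)
qed

text \<open>In row \<open>r\<close> the columns \<open>j\<close> and \<open>j + 1\<close> read the
  indices \<open>g r\<close> and \<open>g 0\<close>, which the transposition interchanges; every
  other row is unchanged.\<close>

lemma enlarged_act_swap:
  assumes part: "is_partition lam" and j: "1 \<le> j"
    and Q: "Q (j + 1) permutes {1..col_len lam (j + 1)}"
    and r: "r \<in> {1..col_len lam (j + 1)}" "Q (j + 1) r = 1"
  shows "same_row_content lam (enlarged_act F j (g \<circ> transpose 0 r) Q) S \<longleftrightarrow>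
    same_row_content lam (enlarged_act F j g Q) S"
proof (rule same_row_content_cong)
  fix s assume s: "s \<in> {1..length lam}"
  show "row_content lam (enlarged_act F j (g \<circ> transpose 0 r) Q) s =
    row_content lam (enlarged_act F j g Q) s"
  proof (cases "s = r")
    case True
    have "(r, j + 1) \<in> young_diagram lam"
      using column_eq[OF part, of "j + 1"] r(1) by blast
    then have "j + 1 \<le> row_len lam s" using True by (simp add: young_diagram_def)
    then show ?thesis
      using j r True
      by (intro row_content_swap[of j _ _ "j + 1"]) (auto simp: enlarged_act_def transpose_def)
  next
    case False
    \<comment> \<open>By injectivity, \<open>r\<close> is the only row that reads
      \<open>g 0\<close>.\<close>
    then have "Q (j + 1) s \<noteq> 1" using r(2) permutes_inj[OF Q] by (metis injD)
    then show ?thesis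
      using False s by (intro row_content_cong) (auto simp: enlarged_act_def transpose_def)
  qed
qed

text \<open>Composition with (0 r) is a sign-reversing bijection preserving the weight, so the
  integer sum equals its own negative.\<close>

lemma signed_sum_enlarged_act_eq_0:
  assumes part: "is_partition lam" and j: "1 \<le> j" "j < row_len lam 1"
    and Q: "Q (j + 1) permutes {1..col_len lam (j + 1)}"
  shows "(\<Sum>g | g permutes {0..col_len lam j}.
    sign g * of_bool (same_row_content lam (enlarged_act F j g Q) S)) = (0::int)"
proof -
  let ?p = "col_len lam j" and ?q = "col_len lam (j + 1)"
  let ?f = "\<lambda>g. sign g * of_bool (same_row_content lam (enlarged_act F j g Q) S) :: int"
  have "(1, j + 1) \<in> young_diagram lam" using j by (simp add: young_diagram_def)
  then have "1 \<in> {1..?q}" using column_eq[OF part, of "j + 1"] by blast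
  then obtain r where r: "r \<in> {1..?q}" "Q (j + 1) r = 1"
    using permutes_image[OF Q] by (metis (no_types, lifting) imageE)
  have "(r, j + 1) \<in> young_diagram lam"
    using column_eq[OF part, of "j + 1"] r(1) by blast
  \<comment> \<open>A row reaching column \<open>j + 1\<close> also reaches column \<open>j\<close>,
    so (0 r) stays inside the enlarged column.\<close>
  then have "(r, j) \<in> young_diagram lam" using j by (simp add: young_diagram_def)
  then have rp: "r \<in> {1..?p}" using column_eq[OF part, of j] by blast
  have t: "transpose 0 r permutes {0..?p}" using rp by (intro permutes_swap_id) auto
  have "(\<Sum>g | g permutes {0..?p}. ?f g) = (\<Sum>g | g permutes {0..?p}. ?f (g \<circ> transpose 0 r))"
    by (rule sum_permutations_compose_right[OF t])
  also have "\<dots> = (\<Sum>g | g permutes {0..?p}. - ?f g)"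
  proof (rule sum.cong)
    fix g assume "g \<in> {g. g permutes {0..?p}}"
    then have "permutation g" by (auto simp: permutation_permutes)
    then have "sign (g \<circ> transpose 0 r) = - sign g"
      using rp by (simp add: sign_compose permutation_swap_id sign_swap_id)
    then show "?f (g \<circ> transpose 0 r) = - ?f g"
      using enlarged_act_swap[where Q = Q and F = F and g = g and S = S, OF part j(1) Q r] by simp
  qed simp
  finally show ?thesis by (simp add: sum_negf)
qed

theorem theorem3p20:
  fixes n :: nat and lam :: "nat list" and z :: "nat \<Rightarrow> nat"
    and F S :: "nat \<times> nat \<Rightarrow> nat" and j p :: nat
  assumes "2 \<le> n"
    and "is_partition lam"
    and "(\<Sum>i\<in>{1..n}. z i) = sum_list lam"
    and "F \<in> fillings n lam" and "S \<in> fillings n lam"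
    and "\<forall>i\<in>{1..n}. content lam F i = z i"
    and "\<forall>i\<in>{1..n}. content lam S i = z i"
    and "cardinal_filling lam F" and "cardinal_filling lam S"
    and "1 \<le> j" and "j < row_len lam 1"
    and "p = col_len lam j"
  shows "rearrangement_coeff lam F S
           - (\<Sum>l\<in>{1..p}. rearrangement_coeff lam (exchange F j l) S) = 0"
proof -
  let ?I = "{1..row_len lam 1}"
  let ?PQ = "\<Pi>\<^sub>E c\<in>?I - {j}. {p. p permutes {1..col_len lam c}}"
  let ?sg = "\<lambda>Q. \<Prod>c\<in>?I - {j}. sign (Q c) :: int"
  \<comment> \<open>This is the sign of \<open>transpose 0 b\<close>, which is the identity for
    \<open>b = 0\<close>; it matches the coefficients of the Pluecker relation.\<close>
  let ?e = "\<lambda>b::nat. if b = 0 then 1 else - 1 :: int"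
  let ?G = "\<lambda>b. if b = 0 then F else exchange F j b"
  let ?ok = "\<lambda>g Q. of_bool (same_row_content lam (enlarged_act F j g Q) S) :: int"
  have jI: "j \<in> ?I" using assms by simp
  have ins: "{0..p} = insert 0 {1..p}" by auto
  have R: "rearrangement_coeff lam (?G b) S = (\<Sum>Q\<in>?PQ. ?sg Q *
      (\<Sum>\<pi> | \<pi> permutes {1..p}. sign \<pi> * ?ok (transpose 0 b \<circ> \<pi>) Q))" if "b \<in> {0..p}" for b
    unfolding rearrangement_coeff_split_column[OF jI] assms(12)[symmetric]
    using same_row_content_act[OF _ that, of _ lam _ j F S]
    by (intro sum.cong arg_cong2[of _ _ _ _ "(*)"]) auto
  have "rearrangement_coeff lam F S - (\<Sum>l\<in>{1..p}. rearrangement_coeff lam (exchange F j l) S)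
      = (\<Sum>b\<in>{0..p}. ?e b * rearrangement_coeff lam (?G b) S)"
    unfolding ins by (simp add: sum_negf)
  also have "\<dots> = (\<Sum>b\<in>{0..p}. \<Sum>Q\<in>?PQ. ?sg Q *
      (\<Sum>\<pi> | \<pi> permutes {1..p}. ?e b * sign \<pi> * ?ok (transpose 0 b \<circ> \<pi>) Q))"
    by (intro sum.cong refl) (simp only: R sum_distrib_left mult_ac)
  also have "\<dots> = (\<Sum>b\<in>{0..p}. \<Sum>Q\<in>?PQ. ?sg Q * (\<Sum>\<pi> | \<pi> permutes {1..p}.
      sign (transpose 0 b \<circ> \<pi>) * ?ok (transpose 0 b \<circ> \<pi>) Q))"
  proof -
    have "sign (transpose 0 b \<circ> \<pi>) = ?e b * sign \<pi>" if "\<pi> permutes {1..p}" for b \<pi>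
    proof -
      have "permutation \<pi>" using that by (auto simp: permutation_permutes)
      then show ?thesis by (simp add: sign_compose permutation_swap_id sign_swap_id)
    qed
    then show ?thesis by (intro sum.cong arg_cong2[of _ _ _ _ "(*)"]) auto
  qed
  also have "\<dots> = (\<Sum>Q\<in>?PQ. ?sg Q * (\<Sum>b\<in>{0..p}. \<Sum>\<pi> | \<pi> permutes {1..p}.
      sign (transpose 0 b \<circ> \<pi>) * ?ok (transpose 0 b \<circ> \<pi>) Q))"
    by (subst sum.swap) (simp only: sum_distrib_left)
  \<comment> \<open>Each permutation of \<open>{0..p}\<close> factors uniquely as
    \<open>transpose 0 b \<circ> \<pi>\<close> with \<open>\<pi>\<close> fixing \<open>0\<close>;
    here \<open>b\<close> is the image of \<open>0\<close>.\<close>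
  also have "\<dots> = (\<Sum>Q\<in>?PQ. ?sg Q * (\<Sum>g | g permutes {0..p}. sign g * ?ok g Q))"
    unfolding ins by (subst sum_over_permutations_insert) auto
  also have "\<dots> = 0"
  proof (intro sum.neutral ballI)
    fix Q assume "Q \<in> ?PQ"
    then have "Q (j + 1) permutes {1..col_len lam (j + 1)}"
      using assms(10,11) by (auto simp: PiE_iff)
    then show "?sg Q * (\<Sum>g | g permutes {0..p}. sign g * ?ok g Q) = 0"
      using signed_sum_enlarged_act_eq_0[OF assms(2,10,11), of Q F S] assms(12) by simp
  qed
  finally show ?thesis .
qed

end
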